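(* Let $1\le\alpha\le n$, let $\Sigma=\{0,1,\dots,m\}$ with $d(a,b)=|a-b|$ and $2\le m\le\alpha$, and let $\delta\le(m+1)^{-1}$. Then there is an absolute constant $C$ such that every $(1-\delta)$-accurate one-way communication protocol for $\mathrm{DTEP}_1^\alpha(\Sigma^{\le Cn})$ has bit complexity $\Omega(n\alpha^{-1}\log m)$.
   Context: A run is a maximal substring of one repeated letter; an expansion is obtained by lengthening runs; a correspondence between $x,y$ is a pair of equal-length expansions $(\bar x,\bar y)$ with cost $\sum_i d(\bar x_i,\bar y_i)$; $\mathrm{DTW}(x,y)$ is the minimum cost. One-way communication: Alice holds $x$, Bob holds $y$; with public randomness Alice sends one message, Bob outputs an answer; $p$-accurate means valid output with probability $\ge p$ for every input pair; bit complexity is maximal message length. $\mathrm{DTEP}_r^\alpha(\Sigma^{\le N})$: inputs $x,y\in\Sigma^{\le N}$; output $0$ is valid if $\mathrm{DTW}(x,y)\le r$ and output $1$ is valid if $\mathrm{DTW}(x,y)>r\alpha$. *)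

theory Defs
  imports "HOL-Probability.Probability"
begin

section \<open>Dynamic time warping\<close>

definition run_encoding :: "('a \<times> nat) list \<Rightarrow> 'a list \<Rightarrow> bool" where
  "run_encoding rs x \<longleftrightarrow>
     (\<forall>(a, k) \<in> set rs. 0 < k) \<and> distinct_adj (map fst rs) \<and>
     x = concat (map (\<lambda>(a, k). replicate k a) rs)"

definition expansion :: "'a list \<Rightarrow> 'a list \<Rightarrow> bool" where
  "expansion x x' \<longleftrightarrow>
     (\<exists>rs rs'. run_encoding rs x \<and> run_encoding rs' x' \<and>
        list_all2 (\<lambda>(a, k) (a', k'). a = a' \<and> k \<le> k') rs rs')"

definition correspondences :: "'a list \<Rightarrow> 'a list \<Rightarrow> ('a list \<times> 'a list) set" where
  "correspondences x y =
     {(x', y'). expansion x x' \<and> expansion y y' \<and> length x' = length y'}"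

definition cost :: "('a \<Rightarrow> 'a \<Rightarrow> real) \<Rightarrow> 'a list \<times> 'a list \<Rightarrow> real" where
  "cost d = (\<lambda>(x', y'). \<Sum>i<length x'. d (x' ! i) (y' ! i))"

text \<open>
  The value is \<open>\<infinity>\<close> when no correspondence exists, i.e. when exactly one of the two strings
  is empty. For the integer-valued distance used below the infimum of a nonempty set of
  costs is attained, so it is the minimum cost.
\<close>

definition DTW :: "('a \<Rightarrow> 'a \<Rightarrow> real) \<Rightarrow> 'a list \<Rightarrow> 'a list \<Rightarrow> ereal" where
  "DTW d x y = (INF c \<in> correspondences x y. ereal (cost d c))"

definition strings_upto :: "'a set \<Rightarrow> nat \<Rightarrow> 'a list set" where
  "strings_upto \<Sigma> N = {x. set x \<subseteq> \<Sigma> \<and> length x \<le> N}"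

definition line_dist :: "nat \<Rightarrow> nat \<Rightarrow> real" where
  "line_dist a b = \<bar>real a - real b\<bar>"


section \<open>One-way communication with public randomness\<close>

text \<open>
  A public random string is an infinite bit string drawn from an arbitrary probability
  measure \<open>rand\<close> on (a sigma-algebra over) a set of such strings. The type of random strings
  is fixed, rather than a type variable, so that constants in a theorem about all protocols
  cannot depend on it.
\<close>

record ('x, 'y, 'o) one_way =
  rand :: "(nat \<Rightarrow> bool) measure"
  alice :: "(nat \<Rightarrow> bool) \<Rightarrow> 'x \<Rightarrow> bool list"
  bob :: "(nat \<Rightarrow> bool) \<Rightarrow> bool list \<Rightarrow> 'y \<Rightarrow> 'o"

definition one_way_protocol :: "'x set \<Rightarrow> 'y set \<Rightarrow> ('x, 'y, 'o) one_way \<Rightarrow> bool" where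
  "one_way_protocol X Y P \<longleftrightarrow>
     prob_space (rand P) \<and>
     (\<forall>x\<in>X. (\<lambda>\<omega>. alice P \<omega> x) \<in> measurable (rand P) (count_space UNIV)) \<and>
     (\<forall>msg. \<forall>y\<in>Y. (\<lambda>\<omega>. bob P \<omega> msg y) \<in> measurable (rand P) (count_space UNIV))"

definition run_protocol :: "('x, 'y, 'o) one_way \<Rightarrow> (nat \<Rightarrow> bool) \<Rightarrow> 'x \<Rightarrow> 'y \<Rightarrow> 'o" where
  "run_protocol P \<omega> x y = bob P \<omega> (alice P \<omega> x) y"

definition accurate ::
    "real \<Rightarrow> 'x set \<Rightarrow> 'y set \<Rightarrow> ('x \<Rightarrow> 'y \<Rightarrow> 'o \<Rightarrow> bool) \<Rightarrow> ('x, 'y, 'o) one_way \<Rightarrow> bool" where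
  "accurate p X Y valid P \<longleftrightarrow>
     (\<forall>x\<in>X. \<forall>y\<in>Y.
        p \<le> measure (rand P) {\<omega> \<in> space (rand P). valid x y (run_protocol P \<omega> x y)})"

definition bit_complexity :: "'x set \<Rightarrow> ('x, 'y, 'o) one_way \<Rightarrow> enat" where
  "bit_complexity X P = (SUP x \<in> X. SUP \<omega> \<in> space (rand P). enat (length (alice P \<omega> x)))"


section \<open>The distance threshold estimation problem\<close>

text \<open>
  The output bit \<open>False\<close> stands for \<open>0\<close> and \<open>True\<close> for \<open>1\<close>. This is a gap problem: if
  \<open>r < DTW d x y \<le> r * \<alpha>\<close>, both outputs are valid.
\<close>

definition DTEP_valid ::
    "('a \<Rightarrow> 'a \<Rightarrow> real) \<Rightarrow> real \<Rightarrow> real \<Rightarrow> 'a list \<Rightarrow> 'a list \<Rightarrow> bool \<Rightarrow> bool" where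
  "DTEP_valid d r \<alpha> x y out \<longleftrightarrow>
     (DTW d x y \<le> ereal r \<longrightarrow> out = False) \<and>
     (DTW d x y > ereal (r * \<alpha>) \<longrightarrow> out = True)"

definition DTEP_protocol ::
    "('a \<Rightarrow> 'a \<Rightarrow> real) \<Rightarrow> real \<Rightarrow> real \<Rightarrow> 'a list set \<Rightarrow> real \<Rightarrow>
     ('a list, 'a list, bool) one_way \<Rightarrow> bool" where
  "DTEP_protocol d r \<alpha> S p P \<longleftrightarrow>
     one_way_protocol S S P \<and> accurate p S S (DTEP_valid d r \<alpha>) P"

end

theory Submission
  imports Defs "HOL-Library.Sublist"
begin

text \<open>
  Both parties hold a concatenation of about \<open>n / \<alpha>\<close> blocks, each an increasing staircase
  \<open>0, 1, \<dots>, T\<close>. Alice encodes a vector \<open>u\<close> in run lengths only: in block \<open>j\<close> the runs of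
  \<open>0\<close>, \<open>u j\<close> and \<open>T\<close> are longer than \<open>\<alpha>\<close>, all others have length one. Bob tests
  \<open>u j = v\<close> by omitting the letter \<open>v\<close> from block \<open>j\<close>. If \<open>u j \<noteq> v\<close>, the missing letter
  costs one. If \<open>u j = v\<close>, a correspondence of cost at most \<open>\<alpha>\<close> would match every long run
  of Alice at a place of equal letter; the alternating long runs of \<open>0\<close> and \<open>T\<close> then
  synchronise the blocks, and the long run of \<open>v\<close> has no partner. With error
  \<open>1 / (m + 1)\<close> a union bound over the letters lets Bob decode any coordinate of a vector
  over an alphabet of size about \<open>m / 3\<close> with probability \<open>2 / 3\<close>, so the message has
  \<open>\<Omega>(n / \<alpha> * log m)\<close> bits.
\<close>

subsection \<open>Stretching\<close>

text \<open>Expansion seen letter by letter instead of run by run, so that proofs go by structural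
  induction on the string without a run decomposition.\<close>

inductive stretch :: "'a list \<Rightarrow> 'a list \<Rightarrow> bool" where
  Nil: "stretch [] []"
| Cons: "0 < k \<Longrightarrow> stretch x x' \<Longrightarrow> stretch (a # x) (replicate k a @ x')"

abbreviation decode_runs :: "('a \<times> nat) list \<Rightarrow> 'a list" where
  "decode_runs rs \<equiv> concat (map (\<lambda>(a, k). replicate k a) rs)"

lemma stretch_appendD:
  "stretch (x @ y) z \<Longrightarrow> \<exists>z1 z2. z = z1 @ z2 \<and> stretch x z1 \<and> stretch y z2"
proof (induction x arbitrary: z)
  case Nil
  then show ?case by (auto intro: stretch.Nil)
next
  case (Cons a x)
  from Cons.prems obtain k x' where k: "0 < k" "stretch (x @ y) x'" "z = replicate k a @ x'"
    by (auto elim: stretch.cases)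
  from Cons.IH[OF k(2)] obtain z1 z2 where "x' = z1 @ z2" "stretch x z1" "stretch y z2" by blast
  with k show ?case
    by (intro exI[of _ "replicate k a @ z1"] exI[of _ z2]) (auto intro: stretch.Cons)
qed

lemma stretch_replicateD: "stretch (replicate k a) z \<Longrightarrow> \<exists>k'\<ge>k. z = replicate k' a"
proof (induction k arbitrary: z)
  case 0
  then show ?case by (auto elim: stretch.cases)
next
  case (Suc k)
  from Suc.prems obtain l x' where l: "0 < l" "stretch (replicate k a) x'" "z = replicate l a @ x'"
    by (auto elim: stretch.cases)
  from Suc.IH[OF l(2)] obtain k' where "k' \<ge> k" "x' = replicate k' a" by blast
  with l show ?case
    by (intro exI[of _ "l + k'"]) (auto simp: replicate_add)
qed

text \<open>All but the last of the \<open>k\<close> copies stay single; the last one absorbs the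
  surplus.\<close>

lemma stretch_replicate_append:
  assumes "0 < k" "k \<le> k'" "stretch x x'"
  shows "stretch (replicate k a @ x) (replicate k' a @ x')"
  using assms
proof (induction k arbitrary: k')
  case 0
  then show ?case by simp
next
  case (Suc k)
  show ?case
  proof (cases "k = 0")
    case True
    with Suc.prems stretch.Cons[of k' x x' a] show ?thesis by simp
  next
    case False
    with Suc.prems have "stretch (replicate k a @ x) (replicate (k' - 1) a @ x')"
      by (intro Suc.IH) auto
    from stretch.Cons[of 1, OF _ this, of a] Suc.prems show ?thesis
      by (cases k') auto
  qed
qed

lemma expansion_imp_stretch:
  assumes "expansion x x'"
  shows "stretch x x'"
proof -
  from assms obtain rs rs' where rs: "\<forall>(a, k) \<in> set rs. 0 < k"
      "list_all2 (\<lambda>(a, k) (a', k'). a = a' \<and> k \<le> k') rs rs'"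
      and x: "x = decode_runs rs" "x' = decode_runs rs'"
    by (auto simp: expansion_def run_encoding_def)
  from rs(2,1) have "stretch (decode_runs rs) (decode_runs rs')"
    by (induction rule: list_all2_induct) (auto intro: stretch.Nil stretch_replicate_append)
  with x show ?thesis by simp
qed

lemma subseq_replicate_appendD:
  "subseq w (replicate k a @ z) \<Longrightarrow> w = [] \<or> hd w \<noteq> a \<Longrightarrow> subseq w z"
  by (induction k) (cases w; auto split: if_splits)+

text \<open>Stretching creates only adjacent equal letters, and \<open>w\<close> has none: once a
  letter of \<open>w\<close> is matched inside a block of copies, the next letter differs and must
  be found after that block.\<close>

lemma subseq_stretchD:
  "stretch y y' \<Longrightarrow> distinct_adj w \<Longrightarrow> subseq w y' \<Longrightarrow> subseq w y"
proof (induction arbitrary: w rule: stretch.induct)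
  case Nil
  then show ?case by simp
next
  case (Cons k x x' a)
  show ?case
  proof (cases w)
    case Nil
    then show ?thesis by simp
  next
    case w: (Cons b w')
    show ?thesis
    proof (cases "b = a")
      case True
      from Cons.hyps(1) obtain l where "k = Suc l" by (cases k) auto
      with Cons.prems(2) w True have "subseq w' (replicate l a @ x')" by simp
      moreover have "w' = [] \<or> hd w' \<noteq> a"
        using Cons.prems(1) w True by (cases w') auto
      ultimately have "subseq w' x'" by (rule subseq_replicate_appendD)
      with Cons.IH[of w'] Cons.prems(1) w True show ?thesis
        by (auto dest: distinct_adj_ConsD)
    next
      case False
      with w subseq_replicate_appendD[OF Cons.prems(2)] have "subseq w x'" by simp
      with Cons.IH Cons.prems(1) show ?thesis by auto
    qed
  qed
qed

lemma subseq_Cons_skip: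
  "a \<notin> set zs \<Longrightarrow> subseq (a # w) (zs @ ys) \<Longrightarrow> subseq (a # w) ys"
  by (induction zs) (auto split: if_splits)

lemma subseq_append_leftD: "subseq (u @ w) y \<Longrightarrow> subseq w y"
  by (meson list_emb_append2 subseq_order.order_refl subseq_order.order_trans)

lemma subseq_count_list_le: "subseq u w \<Longrightarrow> count_list u a \<le> count_list w a"
  by (induction rule: list_emb.induct) auto

subsection \<open>Dynamic time warping on the line\<close>

lemma cost_eq_sum_list:
  "length x = length y \<Longrightarrow> cost d (x, y) = sum_list (map2 d x y)"
  unfolding cost_def by (simp add: sum_list_sum_nth atLeast0LessThan)

lemma line_dist_same_sum [simp]: "sum_list (map2 line_dist x x) = 0"
  by (induction x) (auto simp: line_dist_def)

lemma line_dist_sum_nonneg: "0 \<le> sum_list (map2 line_dist x y)"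
  by (intro sum_list_nonneg) (auto simp: line_dist_def)

lemma line_dist_sum_replicate_ge:
  "a \<notin> set y \<Longrightarrow> real (length y) \<le> sum_list (map2 line_dist (replicate (length y) a) y)"
proof (induction y)
  case (Cons b y)
  then have "1 \<le> line_dist a b" by (auto simp: line_dist_def)
  with Cons show ?case by simp
qed simp

text \<open>Stretching keeps a run of length at least \<open>L\<close> that long. If the aligned
  segment of \<open>y'\<close> lacked its letter, every position there would cost at least one and
  the total would reach \<open>L\<close>. The aligned segments are disjoint and ordered, hence the
  subsequence.\<close>

lemma long_runs_subseq:
  assumes "stretch (decode_runs rs) x'" "length x' = length y'"
    "sum_list (map2 line_dist x' y') < real L"
  shows "subseq (map fst (filter (\<lambda>(a, k). L \<le> k) rs)) y'"
  using assms
proof (induction rs arbitrary: x' y')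
  case Nil
  then show ?case by simp
next
  case (Cons r rs)
  obtain a k where r: "r = (a, k)" by force
  from Cons.prems(1) r stretch_appendD[of "replicate k a" "decode_runs rs" x']
  obtain z1 x2 where z: "x' = z1 @ x2" "stretch (replicate k a) z1" "stretch (decode_runs rs) x2"
    by auto
  from stretch_replicateD[OF z(2)] obtain k' where k': "k' \<ge> k" "z1 = replicate k' a" by blast
  define y1 y2 where "y1 = take k' y'" and "y2 = drop k' y'"
  have y: "y' = y1 @ y2" "length y1 = k'" "length x2 = length y2"
    using Cons.prems(2) z k' by (auto simp: y1_def y2_def)
  have S: "sum_list (map2 line_dist x' y') =
      sum_list (map2 line_dist z1 y1) + sum_list (map2 line_dist x2 y2)"
    using y k' z by simp
  have "sum_list (map2 line_dist x2 y2) < real L"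
    using Cons.prems(3) S line_dist_sum_nonneg[of z1 y1] by linarith
  with Cons.IH[OF z(3) y(3)]
  have sub: "subseq (map fst (filter (\<lambda>(a, k). L \<le> k) rs)) y2" by simp
  show ?case
  proof (cases "L \<le> k")
    case True
    have "a \<in> set y1"
    proof (rule ccontr)
      assume "a \<notin> set y1"
      from line_dist_sum_replicate_ge[OF this] y(2) k'
      have "real k' \<le> sum_list (map2 line_dist z1 y1)" by simp
      with S Cons.prems(3) line_dist_sum_nonneg[of x2 y2] True k' show False by linarith
    qed
    then have "subseq [a] y1" by (simp add: subseq_singleton_left)
    from list_emb_append_mono[OF this sub] show ?thesis using True r y by simp
  next
    case False
    with sub r y show ?thesis by (simp add: list_emb_append2)
  qed
qed

subsection \<open>The hard instances\<close>

text \<open>The value \<open>u = 0\<close> gives no long run beyond those of 0 and \<open>T\<close>,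
  so it serves as an additional symbol for which Bob has no test.\<close>

definition block_runs :: "nat \<Rightarrow> nat \<Rightarrow> nat \<Rightarrow> (nat \<times> nat) list" where
  "block_runs T L u = map (\<lambda>a. (a, if a \<in> {0, u, T} then L else 1)) [0..<Suc T]"

definition alice_string :: "nat \<Rightarrow> nat \<Rightarrow> nat list \<Rightarrow> nat list" where
  "alice_string T L us = decode_runs (concat (map (block_runs T L) us))"

definition bob_string :: "nat \<Rightarrow> nat \<Rightarrow> nat \<Rightarrow> nat \<Rightarrow> nat list" where
  "bob_string T K j v =
     concat (replicate j [0..<Suc T]) @ ([0..<v] @ [Suc v..<Suc T]) @
     concat (replicate (K - Suc j) [0..<Suc T])"

section \<open>Run structure of the two strings\<close>

lemma distinct_imp_distinct_adj: "distinct xs \<Longrightarrow> distinct_adj xs"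
  by (induction xs rule: induct_list012) auto

lemma fst_block_runs: "map fst (block_runs T L u) = [0..<Suc T]"
  by (simp add: block_runs_def comp_def del: upt_Suc)

lemma fst_blocks:
  "map fst (concat (map (block_runs T L) us)) = concat (replicate (length us) [0..<Suc T])"
  by (induction us) (simp_all add: fst_block_runs del: upt_Suc)

lemma distinct_adj_concat:
  assumes "\<And>b. b \<in> set bs \<Longrightarrow> b \<noteq> [] \<and> hd b = s \<and> last b = t \<and> distinct_adj b" "s \<noteq> t"
  shows "distinct_adj (concat bs)"
  using assms(1)
proof (induction bs)
  case (Cons b bs)
  have "concat bs = [] \<or> hd (concat bs) = s"
    using Cons.prems by (cases bs) (auto simp: hd_append)
  with Cons assms(2) show ?case
    by (auto simp: distinct_adj_append_iff)
qed simp

lemma distinct_adj_blocks: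
  assumes "0 < T"
  shows "distinct_adj (concat (replicate k [0..<Suc T]))"
proof (rule distinct_adj_concat)
  fix b assume "b \<in> set (replicate k [0..<Suc T])"
  with assms show "b \<noteq> [] \<and> hd b = 0 \<and> last b = T \<and> distinct_adj b"
    by (auto intro: distinct_imp_distinct_adj simp: set_replicate_conv_if
        simp del: upt_Suc split: if_splits)
qed (use assms in simp)

lemma distinct_adj_bob_string:
  assumes "0 < v" "v < T"
  shows "distinct_adj (bob_string T K j v)"
proof -
  let ?bs = "replicate j [0..<Suc T] @ [[0..<v] @ [Suc v..<Suc T]] @
    replicate (K - Suc j) [0..<Suc T]"
  have "distinct_adj (concat ?bs)"
  proof (rule distinct_adj_concat)
    fix b assume "b \<in> set ?bs"
    then have "b = [0..<Suc T] \<or> b = [0..<v] @ [Suc v..<Suc T]"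
      by (auto simp: set_replicate_conv_if simp del: upt_Suc split: if_splits)
    with assms show "b \<noteq> [] \<and> hd b = 0 \<and> last b = T \<and> distinct_adj b"
      by (auto intro!: distinct_imp_distinct_adj simp: hd_append)
  qed (use assms in simp)
  then show ?thesis by (simp add: bob_string_def del: upt_Suc)
qed

lemma decode_runs_ones: "decode_runs (map (\<lambda>a. (a, Suc 0)) xs) = xs"
  by (induction xs) auto

lemma distinct_adj_run_encoding:
  "distinct_adj xs \<Longrightarrow> run_encoding (map (\<lambda>a. (a, 1)) xs) xs"
  by (auto simp: run_encoding_def decode_runs_ones comp_def)

text \<open>Since \<open>u\<close> differs from \<open>v\<close>, the run of \<open>v\<close> is a
  single letter. The run of \<open>v - 1\<close> is singled out because it will stand in for the
  letter missing on Bob's side.\<close>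

lemma block_runs_split:
  assumes "0 < v" "v < T" "u \<noteq> v"
  obtains A B where
    "block_runs T L u = A @ [(v - 1, if v - 1 \<in> {0, u, T} then L else 1), (v, 1)] @ B"
    "map fst A = [0..<v - 1]" "map fst B = [Suc v..<Suc T]"
    "\<forall>(a, k)\<in>set A \<union> set B. k = L \<or> k = 1"
proof -
  have "[0..<Suc T] = [0..<v - 1] @ [v - 1, v] @ [Suc v..<Suc T]"
  proof -
    have "[0..<Suc T] = [0..<v - 1] @ [v - 1..<Suc T]"
      using upt_add_eq_append[of 0 "v - 1" "Suc T - (v - 1)"] assms by (simp del: upt_Suc)
    moreover have "[v - 1..<Suc T] = [v - 1, v] @ [Suc v..<Suc T]"
      using assms by (simp add: upt_conv_Cons del: upt_Suc)
    ultimately show ?thesis by simp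
  qed
  then show ?thesis
    using assms
    by (intro that[of "map (\<lambda>a. (a, if a \<in> {0, u, T} then L else 1)) [0..<v - 1]"
          "map (\<lambda>a. (a, if a \<in> {0, u, T} then L else 1)) [Suc v..<Suc T]"])
      (auto simp: block_runs_def comp_def simp del: upt_Suc)
qed

text \<open>Alice's string stays as it is. Bob's is expanded to her run lengths, with one more copy
  of \<open>v - 1\<close> where she has the single \<open>v\<close>; that position alone costs
  anything, namely one.\<close>

lemma DTW_le_one:
  assumes v: "0 < v" "v < T" and L: "0 < L" and j: "j < length us" and ne: "us ! j \<noteq> v"
  shows "DTW line_dist (alice_string T L us) (bob_string T (length us) j v) \<le> 1"
proof -
  define us1 us2 where "us1 = take j us" and "us2 = drop (Suc j) us"
  have us: "us = us1 @ us ! j # us2" "length us1 = j" "length us2 = length us - Suc j"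
    using j id_take_nth_drop[OF j] by (auto simp: us1_def us2_def)
  define l where "l = (if v - 1 \<in> {0, us ! j, T} then L else 1)"
  obtain A B where AB: "block_runs T L (us ! j) = A @ [(v - 1, l), (v, 1)] @ B"
    "map fst A = [0..<v - 1]" "map fst B = [Suc v..<Suc T]"
    "\<forall>(a, k)\<in>set A \<union> set B. k = L \<or> k = 1"
    using that unfolding l_def by (rule block_runs_split[OF v ne])
  have l: "0 < l" using L by (simp add: l_def)
  define X1 X2 where "X1 = concat (map (block_runs T L) us1)"
    and "X2 = concat (map (block_runs T L) us2)"
  define rx where "rx = X1 @ A @ [(v - 1, l), (v, 1)] @ B @ X2"
  define ry where "ry = X1 @ A @ [(v - 1, Suc l)] @ B @ X2"
  have rx: "rx = concat (map (block_runs T L) us)"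
    by (subst us(1)) (simp add: rx_def X1_def X2_def AB(1))
  have pos_blocks: "\<forall>(a, k)\<in>set X1 \<union> set X2. 0 < k"
    using L by (auto simp: X1_def X2_def block_runs_def)
  have "\<forall>(a, k)\<in>set A \<union> set B. 0 < k"
    using AB(4) L by fastforce
  with pos_blocks l have pos: "\<forall>(a, k)\<in>set rx. 0 < k" "\<forall>(a, k)\<in>set ry. 0 < k"
    by (auto simp: rx_def ry_def)
  let ?x = "alice_string T L us" and ?y = "bob_string T (length us) j v"
  have "run_encoding rx ?x"
    using pos(1) v distinct_adj_blocks[of T "length us"]
    unfolding run_encoding_def alice_string_def rx fst_blocks by auto
  then have ex: "expansion ?x ?x"
    unfolding expansion_def by (intro exI[of _ rx]) (auto simp: list_all2_same)
  have "[0..<v] = [0..<v - 1] @ [v - 1]"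
    using v upt_Suc_append[of 0 "v - 1"] by simp
  then have fst_ry: "map fst ry = ?y"
    by (simp add: ry_def X1_def X2_def fst_blocks AB us(2,3) bob_string_def del: upt_Suc)
  have "run_encoding ry (decode_runs ry)"
    using pos(2) distinct_adj_bob_string[OF v] by (auto simp: run_encoding_def fst_ry)
  \<comment> \<open>All runs of Bob's string have length one, so any positive run lengths over the
    same letters yield an expansion of it.\<close>
  moreover have "run_encoding (map (\<lambda>a. (a, 1)) ?y) ?y"
    by (rule distinct_adj_run_encoding[OF distinct_adj_bob_string[OF v]])
  moreover have "list_all2 (\<lambda>(a, k) (a', k'). a = a' \<and> k \<le> k') (map (\<lambda>a. (a, 1)) ?y) ry"
    using pos(2) unfolding fst_ry[symmetric]
    by (auto simp: list_all2_map1 list_all2_same Suc_le_eq simp del: map_map)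
  ultimately have ey: "expansion ?y (decode_runs ry)"
    unfolding expansion_def by blast
  define p s where "p = decode_runs (X1 @ A) @ replicate l (v - 1)" and "s = decode_runs (B @ X2)"
  have x: "?x = p @ [v] @ s"
    unfolding alice_string_def rx[symmetric] by (simp add: rx_def p_def s_def)
  have y: "decode_runs ry = p @ [v - 1] @ s"
    by (simp add: ry_def p_def s_def replicate_append_same flip: replicate_Suc)
  have "(?x, decode_runs ry) \<in> correspondences ?x ?y"
    using ex ey by (simp add: correspondences_def x y)
  moreover have "cost line_dist (?x, decode_runs ry) = 1"
    using v by (subst cost_eq_sum_list) (auto simp: x y line_dist_def)
  ultimately show ?thesis
    unfolding DTW_def by (metis INF_lower one_ereal_def)
qed

section \<open>Large distance when the tested letter agrees\<close>

definition long_letters :: "nat \<Rightarrow> nat \<Rightarrow> nat list" where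
  "long_letters T u = filter (\<lambda>a. a \<in> {0, u, T}) [0..<Suc T]"

text \<open>Runs have length \<open>L\<close> or one, and \<open>2 <= L\<close> separates the two.
  For \<open>0 < T\<close> the surviving letters are 0, \<open>u\<close>, \<open>T\<close>, or only
  0, \<open>T\<close> when \<open>u\<close> is not strictly between them.\<close>

lemma long_letters_block_runs:
  "2 \<le> L \<Longrightarrow> map fst (filter (\<lambda>(a, k). L \<le> k) (block_runs T L u)) = long_letters T u"
  by (simp add: block_runs_def long_letters_def filter_map comp_def if_distrib[of "(\<le>) L"]
        cong: if_cong del: upt_Suc)

lemma long_letters_blocks:
  "2 \<le> L \<Longrightarrow> map fst (filter (\<lambda>(a, k). L \<le> k) (concat (map (block_runs T L) us))) =
     concat (map (long_letters T) us)"
  by (induction us) (simp_all add: long_letters_block_runs)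

lemma long_letters_snoc:
  assumes "0 < T"
  obtains p where "long_letters T u = 0 # p @ [T]" "T \<notin> set p"
proof -
  have "[0..<Suc T] = 0 # [1..<T] @ [T]" using assms by (simp add: upt_conv_Cons)
  then show ?thesis
    by (intro that[of "filter (\<lambda>a. a \<in> {0, u, T}) [1..<T]"])
      (auto simp: long_letters_def simp del: upt_Suc)
qed

lemma long_letters_split:
  assumes "0 < v" "v < T"
  obtains p q where "long_letters T v = p @ v # q @ [T]"
proof -
  have "[0..<Suc T] = [0..<v] @ v # [Suc v..<T] @ [T]"
    using assms upt_add_eq_append[of 0 v "T - v"] by (simp add: upt_conv_Cons)
  then show ?thesis
    by (intro that[of "filter (\<lambda>a. a \<in> {0, v, T}) [0..<v]" "filter (\<lambda>a. a \<in> {0, v, T}) [Suc v..<T]"])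
      (auto simp: long_letters_def simp del: upt_Suc)
qed

lemma distinct_adj_long_letters:
  assumes "0 < T"
  shows "distinct_adj (concat (map (long_letters T) us))"
proof (rule distinct_adj_concat)
  fix b assume "b \<in> set (map (long_letters T) us)"
  then obtain u where u: "b = long_letters T u" by auto
  obtain p where "long_letters T u = 0 # p @ [T]" by (rule long_letters_snoc[OF assms])
  moreover have "distinct_adj (long_letters T u)"
    by (rule distinct_imp_distinct_adj) (simp add: long_letters_def)
  ultimately show "b \<noteq> [] \<and> hd b = 0 \<and> last b = T \<and> distinct_adj b"
    using u by simp
qed (use assms in simp)

lemma count_long_letters:
  assumes "0 < T"
  shows "count_list (concat (map (long_letters T) us)) T = length us"
proof (induction us)
  case (Cons u us)
  obtain p where "long_letters T u = 0 # p @ [T]" "T \<notin> set p"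
    by (rule long_letters_snoc[OF assms])
  with Cons assms show ?case by simp
qed simp

lemma count_blocks: "count_list (concat (replicate k [0..<Suc T])) T = k"
  by (induction k) auto

text \<open>In a full block of Bob \<open>T\<close> occurs only at the end, so each block of the
  pattern before block \<open>j\<close> uses up at least one full block of Bob. In block
  \<open>j\<close> the letter \<open>v\<close> is missing and has to be matched in a later block; by
  then fewer copies of \<open>T\<close> remain on Bob's side than the pattern still needs.\<close>

lemma long_letters_not_subseq:
  assumes v: "0 < v" "v < T" and "j < length us" "us ! j = v"
  shows "\<not> subseq (concat (map (long_letters T) us)) (bob_string T (length us) j v)"
  using assms(3,4)
proof (induction j arbitrary: us)
  case 0
  then obtain us' where us: "us = v # us'" by (cases us) auto
  obtain p q where pq: "long_letters T v = p @ v # q @ [T]" by (rule long_letters_split[OF v])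
  let ?w = "q @ T # concat (map (long_letters T) us')"
  show ?case
  proof
    assume "subseq (concat (map (long_letters T) us)) (bob_string T (length us) 0 v)"
    then have "subseq (p @ v # ?w)
        (([0..<v] @ [Suc v..<Suc T]) @ concat (replicate (length us') [0..<Suc T]))"
      by (simp add: us pq bob_string_def del: upt_Suc)
    then have "subseq (v # ?w)
        (([0..<v] @ [Suc v..<Suc T]) @ concat (replicate (length us') [0..<Suc T]))"
      by (rule subseq_append_leftD)
    then have "subseq (v # ?w) (concat (replicate (length us') [0..<Suc T]))"
      by (rule subseq_Cons_skip[rotated]) auto
    \<comment> \<open>The pattern still contains the \<open>T\<close> of its current block and one
      for each block of \<open>us'\<close>, while Bob has only the latter number left.\<close>
    from subseq_count_list_le[OF this, of T] v show False
      by (simp add: count_blocks count_long_letters del: upt_Suc)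
  qed
next
  case (Suc j)
  then obtain u us' where us: "us = u # us'" by (cases us) auto
  obtain p where p: "long_letters T u = 0 # p @ [T]"
    using v by (auto intro: long_letters_snoc[of T u])
  have "\<not> subseq (concat (map (long_letters T) us')) (bob_string T (length us') j v)"
    using Suc us by simp
  then show ?case
  proof (rule contrapos_nn)
    assume "subseq (concat (map (long_letters T) us)) (bob_string T (length us) (Suc j) v)"
    then have "subseq ((0 # p) @ T # concat (map (long_letters T) us'))
        ([0..<T] @ T # bob_string T (length us') j v)"
      by (simp add: us p bob_string_def)
    then have "subseq (T # concat (map (long_letters T) us'))
        ([0..<T] @ T # bob_string T (length us') j v)"
      by (rule subseq_append_leftD)
    then have "subseq (T # concat (map (long_letters T) us')) (T # bob_string T (length us') j v)"
      by (rule subseq_Cons_skip[rotated]) auto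
    then show "subseq (concat (map (long_letters T) us')) (bob_string T (length us') j v)"
      by simp
  qed
qed

text \<open>A correspondence cheaper than \<open>L\<close> would embed the letters of Alice's long
  runs into the expansion of Bob's string. These letters have no adjacent repetition, so they would
  already embed into the string itself.\<close>

lemma DTW_ge_run_length:
  assumes v: "0 < v" "v < T" and L: "2 \<le> L" and j: "j < length us" "us ! j = v"
  shows "ereal (real L) \<le> DTW line_dist (alice_string T L us) (bob_string T (length us) j v)"
  unfolding DTW_def
proof (rule INF_greatest, clarify)
  fix x' y'
  assume "(x', y') \<in> correspondences (alice_string T L us) (bob_string T (length us) j v)"
  then have st: "stretch (alice_string T L us) x'" "stretch (bob_string T (length us) j v) y'"
    and len: "length x' = length y'"
    by (auto simp: correspondences_def intro: expansion_imp_stretch)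
  show "ereal (real L) \<le> ereal (cost line_dist (x', y'))"
  proof (rule ccontr)
    assume "\<not> ?thesis"
    then have "sum_list (map2 line_dist x' y') < real L" by (simp add: cost_eq_sum_list len)
    from long_runs_subseq[OF st(1)[unfolded alice_string_def] len this] L
    have "subseq (concat (map (long_letters T) us)) y'" by (simp add: long_letters_blocks)
    from subseq_stretchD[OF st(2) _ this] v distinct_adj_long_letters[of T us]
      long_letters_not_subseq[OF v j]
    show False by simp
  qed
qed

section \<open>Lengths and alphabets of the two strings\<close>

lemma length_alice_string: "length (alice_string T L us) \<le> length us * (3 * L + Suc T)"
proof -
  have "length (decode_runs (block_runs T L u)) \<le> 3 * L + Suc T" for u
  proof -
    have "length (decode_runs (block_runs T L u)) = (\<Sum>a<Suc T. if a \<in> {0, u, T} then L else 1)"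
      by (simp add: block_runs_def length_concat comp_def sum_list_sum_nth atLeast0LessThan
          del: upt_Suc sum.lessThan_Suc)
    also have "\<dots> \<le> (\<Sum>a<Suc T. (if a \<in> {0, u, T} then L else 0) + 1)"
      by (intro sum_mono) auto
    also have "\<dots> = (\<Sum>a\<in>{..<Suc T} \<inter> {0, u, T}. L) + Suc T"
      by (subst sum.distrib, subst sum.inter_restrict) simp_all
    also have "\<dots> \<le> 3 * L + Suc T"
    proof -
      have "card ({..<Suc T} \<inter> {0, u, T}) \<le> card {0, u, T}" by (rule card_mono) auto
      also have "\<dots> \<le> 3" by (simp add: card_insert_if)
      finally show ?thesis by (simp add: mult_le_mono)
    qed
    finally show ?thesis .
  qed
  note block = this
  show ?thesis
    unfolding alice_string_def
  proof (induction us)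
    case (Cons u us)
    from add_mono[OF block[of u] Cons] show ?case by simp
  qed simp
qed

lemma set_alice_string: "set (alice_string T L us) \<subseteq> {0..T}"
  by (auto simp: alice_string_def block_runs_def)

lemma length_bob_string:
  assumes "j < K" "v \<le> T"
  shows "length (bob_string T K j v) \<le> K * Suc T"
proof -
  have "length (bob_string T K j v) \<le> j * Suc T + Suc T + (K - Suc j) * Suc T"
    using assms(2) by (simp add: bob_string_def length_concat sum_list_replicate)
  also have "\<dots> = (j + 1 + (K - Suc j)) * Suc T" by (simp add: algebra_simps)
  finally show ?thesis using assms(1) by simp
qed

lemma set_bob_string: "v \<le> T \<Longrightarrow> set (bob_string T K j v) \<subseteq> {0..T}"
  by (auto simp: bob_string_def set_replicate_conv_if split: if_splits)

subsection \<open>One-way communication complexity of indexing\<close>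

text \<open>The exponential moment of the number of agreements factors over the coordinates of
  \<open>u\<close>. Each factor is \<open>q + (q - 1)\<close>, or just \<open>q\<close> when the
  guess \<open>g j\<close> lies outside the alphabet.\<close>

lemma sum_prod_agreement:
  fixes g :: "nat \<Rightarrow> nat"
  assumes "0 < q"
  shows "(\<Sum>u\<in>{..<K} \<rightarrow>\<^sub>E {..<q}. real q ^ card {j. j < K \<and> g j = u j}) \<le> (2 * real q - 1) ^ K"
proof -
  have "real q ^ card {j. j < K \<and> g j = u j} = (\<Prod>j<K. if g j = u j then real q else 1)"
    for u :: "nat \<Rightarrow> nat"
    by (simp add: prod.If_cases lessThan_def Int_def conj_commute)
  then have "(\<Sum>u\<in>{..<K} \<rightarrow>\<^sub>E {..<q}. real q ^ card {j. j < K \<and> g j = u j}) =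
      (\<Prod>j<K. \<Sum>b<q. if g j = b then real q else 1)"
    by (simp add: prod_sum_PiE)
  also have "\<dots> \<le> (\<Prod>j<K. 2 * real q - 1)"
  proof (intro prod_mono conjI)
    fix j
    show "0 \<le> (\<Sum>b<q. if g j = b then real q else 1)" by (intro sum_nonneg) auto
    have "(\<Sum>b<q. if g j = b then real q else 1) =
        (\<Sum>b<q. (if g j = b then real q - 1 else 0) + 1)"
      by (intro sum.cong) auto
    also have "\<dots> = (if g j < q then real q - 1 else 0) + real q"
      by (simp add: sum.distrib)
    also have "\<dots> \<le> 2 * real q - 1" using assms by simp
    finally show "(\<Sum>b<q. if g j = b then real q else 1) \<le> 2 * real q - 1" .
  qed
  finally show ?thesis by simp
qed

text \<open>The exponent has to stay below \<open>5/3 = 1 + 2/3\<close>, the one obtained from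
  success rate \<open>2/3\<close>. The value \<open>8/5\<close> is admissible already at
  \<open>q = 2\<close>, where \<open>3^5 = 243 <= 256 = 2^8\<close>.\<close>

lemma two_q_minus_one_le:
  assumes "2 \<le> q"
  shows "2 * real q - 1 \<le> real q powr (8 / 5)"
proof -
  have "(2 * real q - 1) ^ 5 \<le> real q ^ 8"
  proof (cases "q = 2 \<or> q = 3")
    case True
    then show ?thesis by auto
  next
    case False
    with assms have q: "4 \<le> real q" by simp
    have "(2 * real q - 1) ^ 5 \<le> (2 * real q) ^ 5" using q by (intro power_mono) auto
    also have "\<dots> = 32 * real q ^ 5" by (simp add: power_mult_distrib)
    also have "\<dots> \<le> real q ^ 3 * real q ^ 5"
      using power_mono[OF q, of 3] by (intro mult_right_mono) auto
    also have "\<dots> = real q ^ 8" by (simp flip: power_add)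
    finally show ?thesis .
  qed
  also have "real q ^ 8 = (real q powr (8 / 5)) ^ 5"
    using assms by (simp add: powr_power)
  finally show ?thesis by (rule power_le_imp_le_base[of _ 4, unfolded Suc_numeral, simplified]) simp
qed

text \<open>Compared with \<open>2 ^ (B + 1)\<close>, this form has no additive constant in the
  exponent, so the final bound stays proportional to \<open>B\<close> even at
  \<open>B = 0\<close>.\<close>

lemma card_short_messages: "card {w :: bool list. length w \<le> B} \<le> 4 ^ B"
proof (induction B)
  case 0
  have "{w :: bool list. w = []} = {[]}" by auto
  then show ?case by simp
next
  case (Suc B)
  have "{w :: bool list. length w \<le> Suc B} =
      insert [] ((#) True ` {w. length w \<le> B} \<union> (#) False ` {w. length w \<le> B})"
    (is "_ = insert [] (?A \<union> ?B)")
  proof (intro set_eqI)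
    fix w :: "bool list"
    show "w \<in> {w. length w \<le> Suc B} \<longleftrightarrow> w \<in> insert [] (?A \<union> ?B)"
    proof (cases w)
      case (Cons b w')
      then show ?thesis by (cases b) auto
    qed simp
  qed
  then have "card {w :: bool list. length w \<le> Suc B} \<le> Suc (card (?A \<union> ?B))"
    using card_insert_le_m1[of "Suc (card (?A \<union> ?B))" "?A \<union> ?B" "[]"] by simp
  also have "card (?A \<union> ?B) \<le> card {w :: bool list. length w \<le> B} + card {w :: bool list. length w \<le> B}"
    by (rule order_trans[OF card_Un_le]) (simp add: card_image)
  finally have "card {w :: bool list. length w \<le> Suc B} \<le> Suc (2 * 4 ^ B)" using Suc by simp
  also have "\<dots> \<le> 4 ^ Suc B" using one_le_power[of "4::nat" B] by simp
  finally show ?case .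
qed

text \<open>
  Comparing the exponential moment of the number of correctly decoded coordinates with its
  lower bound from Jensen's inequality works uniformly down to \<open>q = 2\<close>, where a crude count
  of Hamming balls would fail.
\<close>

lemma deterministic_indexing:
  fixes enc :: "(nat \<Rightarrow> nat) \<Rightarrow> bool list" and dec :: "bool list \<Rightarrow> nat \<Rightarrow> nat"
  assumes q: "2 \<le> q"
    and short: "\<And>u. u \<in> {..<K} \<rightarrow>\<^sub>E {..<q} \<Longrightarrow> length (enc u) \<le> B"
    and correct: "2 / 3 * real K * real q ^ K \<le>
      (\<Sum>u\<in>{..<K} \<rightarrow>\<^sub>E {..<q}. real (card {j. j < K \<and> dec (enc u) j = u j}))"
  shows "real K * log 2 (real q) \<le> 30 * real B"
proof -
  let ?U = "{..<K} \<rightarrow>\<^sub>E {..<q}"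
  let ?M = "{w :: bool list. length w \<le> B}"
  let ?a = "\<lambda>w u. card {j. j < K \<and> dec w j = u j}"
  define c where "c = 2 / 3 * real K"
  have q0: "0 < real q" using q by simp
  have finU: "finite ?U" by (intro finite_PiE) auto
  have finM: "finite ?M" using finite_lists_length_le[of "UNIV :: bool set" B] by simp
  have cardU: "card ?U = q ^ K" by (simp add: card_PiE)
  \<comment> \<open>Tangent to the convex function \<open>q ^ k\<close> at \<open>c\<close>, the
    average agreement guaranteed by \<open>correct\<close>. Summed over \<open>u\<close> it gives
    Jensen's inequality, the linear term being nonnegative.\<close>
  have tangent: "real q powr c * (1 + ln (real q) * (real k - c)) \<le> real q ^ k" for k
  proof -
    have "1 + ln (real q) * (real k - c) \<le> exp (ln (real q) * (real k - c))"
      by (rule exp_ge_add_one_self)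
    also have "\<dots> = real q powr (real k - c)" using q0 by (simp add: powr_def mult.commute)
    finally have "real q powr c * (1 + ln (real q) * (real k - c)) \<le>
        real q powr c * real q powr (real k - c)"
      by (intro mult_left_mono) auto
    also have "\<dots> = real q ^ k" using q0 by (simp flip: powr_add add: powr_realpow)
    finally show ?thesis .
  qed
  have "real q powr c * real q ^ K \<le>
      real q powr c * (real q ^ K + ln (real q) * ((\<Sum>u\<in>?U. real (?a (enc u) u)) - c * real q ^ K))"
    using correct q by (intro mult_left_mono) (auto simp: c_def)
  also have "\<dots> = (\<Sum>u\<in>?U. real q powr c * (1 + ln (real q) * (real (?a (enc u) u) - c)))"
    by (simp add: sum.distrib sum_subtractf cardU algebra_simps flip: sum_distrib_left)
  also have "\<dots> \<le> (\<Sum>u\<in>?U. real q ^ ?a (enc u) u)"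
    by (intro sum_mono tangent)
  \<comment> \<open>Summing over all messages instead of the one sent makes the decoded vector
    independent of \<open>u\<close>, so that the product formula applies for each fixed
    message.\<close>
  also have "\<dots> \<le> (\<Sum>u\<in>?U. \<Sum>w\<in>?M. real q ^ ?a w u)"
    using short finM by (intro sum_mono member_le_sum) auto
  also have "\<dots> = (\<Sum>w\<in>?M. \<Sum>u\<in>?U. real q ^ ?a w u)"
    by (rule sum.swap)
  also have "\<dots> \<le> (\<Sum>w\<in>?M. (2 * real q - 1) ^ K)"
    using q by (intro sum_mono sum_prod_agreement) simp
  also have "\<dots> = real (card ?M) * (2 * real q - 1) ^ K" by (rule sum_constant)
  also have "\<dots> \<le> 4 ^ B * (real q powr (8 / 5)) ^ K"
  proof (intro mult_mono power_mono)
    show "real (card ?M) \<le> 4 ^ B" using of_nat_mono[OF card_short_messages[of B], where 'a = real] by simp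
  qed (use q two_q_minus_one_le[OF q] in auto)
  finally have "real q powr (2 / 3 * real K) * real q ^ K \<le> 4 ^ B * (real q powr (8 / 5)) ^ K"
    by (simp add: c_def)
  then have "ln (real q powr (2 / 3 * real K) * real q ^ K) \<le> ln (4 ^ B * (real q powr (8 / 5)) ^ K)"
    using q0 by (subst ln_le_cancel_iff) auto
  then have "(2 / 3 * real K + real K) * ln (real q) \<le> real B * ln 4 + 8 / 5 * real K * ln (real q)"
    using q0 by (simp add: ln_mult ln_realpow algebra_simps)
  moreover have "ln (4::real) = 2 * ln 2" using ln_realpow[of 2 2] by simp
  \<comment> \<open>The gap \<open>5/3 - 8/5 = 1/15\<close> together with
    \<open>ln 4 = 2 * ln 2\<close> produces the constant 30.\<close>
  ultimately have "real K * ln (real q) \<le> 30 * real B * ln 2"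
    by (simp add: algebra_simps)
  then show ?thesis
    by (simp add: log_def field_simps)
qed

text \<open>Some random string does at least as well as the average over all inputs and coordinates;
  fixing it gives a deterministic protocol. The events \<open>A u j\<close> carry the measurability,
  and the decoder has to succeed on them.\<close>

lemma randomized_indexing:
  fixes enc :: "'w \<Rightarrow> (nat \<Rightarrow> nat) \<Rightarrow> bool list" and dec :: "'w \<Rightarrow> bool list \<Rightarrow> nat \<Rightarrow> nat"
  assumes "prob_space M" and q: "2 \<le> q"
    and short: "\<And>\<omega> u. \<omega> \<in> space M \<Longrightarrow> u \<in> {..<K} \<rightarrow>\<^sub>E {..<q} \<Longrightarrow> length (enc \<omega> u) \<le> B"
    and ev: "\<And>u j. u \<in> {..<K} \<rightarrow>\<^sub>E {..<q} \<Longrightarrow> j < K \<Longrightarrow> A u j \<in> sets M"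
    and pr: "\<And>u j. u \<in> {..<K} \<rightarrow>\<^sub>E {..<q} \<Longrightarrow> j < K \<Longrightarrow> 2 / 3 \<le> measure M (A u j)"
    and dec: "\<And>u j \<omega>. u \<in> {..<K} \<rightarrow>\<^sub>E {..<q} \<Longrightarrow> j < K \<Longrightarrow> \<omega> \<in> A u j \<Longrightarrow> dec \<omega> (enc \<omega> u) j = u j"
  shows "real K * log 2 (real q) \<le> 30 * real B"
proof -
  interpret prob_space M by fact
  let ?U = "{..<K} \<rightarrow>\<^sub>E {..<q}"
  let ?c = "2 / 3 * real K * real q ^ K"
  define f where "f \<omega> = (\<Sum>u\<in>?U. \<Sum>j<K. indicator (A u j) \<omega> :: real)" for \<omega>
  have int: "integrable M (indicator (A u j) :: _ \<Rightarrow> real)" if "u \<in> ?U" "j < K" for u j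
    using ev[OF that] by (simp add: emeasure_eq_measure)
  have "?c = (\<Sum>u\<in>?U. \<Sum>j<K. 2 / 3)" by (simp add: card_PiE)
  also have "\<dots> \<le> (\<Sum>u\<in>?U. \<Sum>j<K. measure M (A u j))"
    using pr by (intro sum_mono) auto
  also have "\<dots> = expectation f"
  proof -
    have "expectation f = (\<Sum>u\<in>?U. expectation (\<lambda>\<omega>. \<Sum>j<K. indicator (A u j) \<omega>))"
      unfolding f_def using int
      by (intro Bochner_Integration.integral_sum Bochner_Integration.integrable_sum) auto
    also have "\<dots> = (\<Sum>u\<in>?U. \<Sum>j<K. expectation (indicator (A u j)))"
      using int by (intro sum.cong refl Bochner_Integration.integral_sum) auto
    also have "\<dots> = (\<Sum>u\<in>?U. \<Sum>j<K. measure M (A u j))"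
      using ev by (intro sum.cong refl) auto
    finally show ?thesis by simp
  qed
  finally have c: "?c \<le> expectation f" .
  have intf: "integrable M f"
    unfolding f_def using int by (intro Bochner_Integration.integrable_sum) auto
  have "\<exists>\<omega>\<in>space M. ?c \<le> f \<omega>"
  proof (rule ccontr)
    assume "\<not> ?thesis"
    then have "AE \<omega> in M. f \<omega> < ?c" by (intro AE_I2) auto
    from expectation_less[OF intf this] c show False by simp
  qed
  then obtain \<omega> where \<omega>: "\<omega> \<in> space M" "?c \<le> f \<omega>" by blast
  have "(\<Sum>j<K. indicator (A u j) \<omega> :: real) \<le> real (card {j. j < K \<and> dec \<omega> (enc \<omega> u) j = u j})"
    if "u \<in> ?U" for u
  proof -
    have "(\<Sum>j<K. indicator (A u j) \<omega> :: real) = real (card {j \<in> {..<K}. \<omega> \<in> A u j})"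
      by (simp add: indicator_def sum.If_cases Int_def)
    also have "\<dots> \<le> real (card {j. j < K \<and> dec \<omega> (enc \<omega> u) j = u j})"
      using dec[OF that] by (intro of_nat_mono card_mono) auto
    finally show ?thesis .
  qed
  then have "f \<omega> \<le> (\<Sum>u\<in>?U. real (card {j. j < K \<and> dec \<omega> (enc \<omega> u) j = u j}))"
    unfolding f_def by (intro sum_mono)
  with \<omega>(2) show ?thesis
    by (intro deterministic_indexing[OF q short[OF \<omega>(1)], where ?dec = "dec \<omega>"]) auto
qed

subsection \<open>From DTW estimation to indexing\<close>

text \<open>The constant 180 is 30 from indexing, times 2 for rounding \<open>n / \<alpha>\<close>
  down, times 3 for passing from \<open>log 2 m\<close> to \<open>log 2 T\<close>.\<close>

lemma DTEP_lower_bound: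
  fixes P :: "(nat list, nat list, bool) one_way"
  assumes \<alpha>: "1 \<le> \<alpha>" "\<alpha> \<le> real n" and m: "2 \<le> m" "real m \<le> \<alpha>"
    and \<delta>: "\<delta> \<le> 1 / (real m + 1)"
    and P: "DTEP_protocol line_dist 1 \<alpha> (strings_upto {0..m} (8 * n)) (1 - \<delta>) P"
    and B: "bit_complexity (strings_upto {0..m} (8 * n)) P = enat B"
  shows "real n / \<alpha> * log 2 (real m) \<le> 180 * real B"
proof -
  \<comment> \<open>The tested letters are \<open>1..t\<close>. The bound
    \<open>3 * t <= m + 1\<close> is what the union bound allows, and the symbols
    \<open>0..t\<close> form an alphabet of size \<open>T\<close>.\<close>
  define t where "t = (m + 1) div 3"
  define T where "T = Suc t"
  define K where "K = nat \<lfloor>real n / \<alpha>\<rfloor>"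
  \<comment> \<open>The least integer above \<alpha>, so that distance at least \<open>L\<close>
    forces the answer \<open>True\<close>.\<close>
  define L where "L = Suc (nat \<lfloor>\<alpha>\<rfloor>)"
  define S where "S = strings_upto {0..m} (8 * n)"
  define X where "X u = alice_string T L (map u [0..<K])" for u
  define Y where "Y j v = bob_string T K j v" for j v
  have t: "1 \<le> t" "T \<le> m" "3 * t \<le> m + 1" "m \<le> 3 * T"
    using m by (auto simp: t_def T_def)
  have L: "2 \<le> L" "\<alpha> < real L" "real L \<le> \<alpha> + 1"
    using \<alpha> by (auto simp: L_def le_nat_iff) linarith+
  have ratio: "1 \<le> real n / \<alpha>" using \<alpha> by simp
  have K: "real K \<le> real n / \<alpha>" "real n / \<alpha> \<le> 2 * real K"
  proof -
    have "1 \<le> \<lfloor>real n / \<alpha>\<rfloor>" using ratio by (simp only: one_le_floor)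
    then show "real K \<le> real n / \<alpha>" "real n / \<alpha> \<le> 2 * real K"
      unfolding K_def by linarith+
  qed
  have size: "K * (3 * L + Suc T) \<le> 8 * n"
  proof -
    \<comment> \<open>Here \<open>3 * L + T + 1 <= 3 * (\<alpha> + 1) + (\<alpha> + 1) <= 8 *
      \<alpha>\<close>, from \<open>T <= m <= \<alpha>\<close> and \<open>1 <= \<alpha>\<close>;
      this is the origin of the factor 8.\<close>
    have "real K * (3 * real L + real (Suc T)) \<le> (real n / \<alpha>) * (8 * \<alpha>)"
      using K(1) L(3) t(2) m \<alpha> by (intro mult_mono) auto
    also have "\<dots> = 8 * real n" using \<alpha> by simp
    finally have "real (K * (3 * L + Suc T)) \<le> real (8 * n)" by (simp only: of_nat_mult of_nat_add of_nat_numeral)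
    then show ?thesis by (simp only: of_nat_le_iff)
  qed
  have XS: "X u \<in> S" for u
    using length_alice_string[of T L "map u [0..<K]"] set_alice_string[of T L "map u [0..<K]"] t(2) size
    by (auto simp: S_def X_def strings_upto_def intro: order_trans)
  have YS: "Y j v \<in> S" if "j < K" "v \<le> T" for j v
  proof -
    have "length (Y j v) \<le> K * Suc T" unfolding Y_def by (rule length_bob_string[OF that])
    also have "\<dots> \<le> K * (3 * L + Suc T)" by simp
    finally show ?thesis
      using set_bob_string[OF that(2), of K j] t(2) size
      by (auto simp: S_def Y_def strings_upto_def)
  qed
  have proto: "one_way_protocol S S P" and acc: "accurate (1 - \<delta>) S S (DTEP_valid line_dist 1 \<alpha>) P"
    using P by (auto simp: DTEP_protocol_def S_def)
  interpret prob_space "rand P" using proto by (simp add: one_way_protocol_def)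
  define V where "V x y = {\<omega> \<in> space (rand P). DTEP_valid line_dist 1 \<alpha> x y (run_protocol P \<omega> x y)}"
    for x y
  have V: "V x y \<in> sets (rand P)" "1 - \<delta> \<le> prob (V x y)" if "x \<in> S" "y \<in> S" for x y
  proof -
    have "\<And>w. (\<lambda>\<omega>. bob P \<omega> w y) \<in> measurable (rand P) (count_space UNIV)"
      "(\<lambda>\<omega>. alice P \<omega> x) \<in> measurable (rand P) (count_space UNIV)"
      using proto that unfolding one_way_protocol_def by blast+
    \<comment> \<open>Messages range over a countable type, so measurability for each fixed message
      suffices.\<close>
    then have "(\<lambda>\<omega>. bob P \<omega> (alice P \<omega> x) y) \<in> measurable (rand P) (count_space UNIV)"
      by (rule measurable_compose_countable)
    from measurable_sets[OF this, of "{b. DTEP_valid line_dist 1 \<alpha> x y b}"]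
    show "V x y \<in> sets (rand P)"
      by (simp add: V_def run_protocol_def vimage_def Int_def conj_commute)
    show "1 - \<delta> \<le> prob (V x y)"
      using acc that by (auto simp: accurate_def V_def)
  qed
  define A where "A u j = (\<Inter>v\<in>{1..t}. V (X u) (Y j v))" for u j
  \<comment> \<open>Accepting test \<open>v\<close> is meant to say \<open>u j = v\<close>. On
    \<open>A u j\<close> at most one test accepts; if none does, the symbol is 0, the only one
    without a test.\<close>
  define dec where "dec \<omega> w j =
      (if \<exists>v\<in>{1..t}. bob P \<omega> w (Y j v) then THE v. v \<in> {1..t} \<and> bob P \<omega> w (Y j v) else 0)"
    for \<omega> w j
  have "real K * log 2 (real T) \<le> 30 * real B"
  proof (rule randomized_indexing[OF prob_space_axioms,
        where enc = "\<lambda>\<omega> u. alice P \<omega> (X u)" and A = A and dec = dec])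
    show "2 \<le> T" using t(1) by (simp add: T_def)
  next
    fix \<omega> u assume "\<omega> \<in> space (rand P)"
    then have "enat (length (alice P \<omega> (X u))) \<le> bit_complexity S P"
      unfolding bit_complexity_def by (intro SUP_upper2[OF XS[of u]] SUP_upper)
    with B show "length (alice P \<omega> (X u)) \<le> B" by (simp add: S_def)
  next
    fix u j assume j: "j < K"
    have YSv: "Y j v \<in> S" if "v \<in> {1..t}" for v using that j by (intro YS) (auto simp: T_def)
    show A: "A u j \<in> sets (rand P)"
      unfolding A_def using t(1) V(1)[OF XS YSv] by (intro sets.finite_INT) auto
    \<comment> \<open>Union bound over the \<open>t\<close> tests, each failing with probability at
      most \<open>1 / (m + 1)\<close>.\<close>
    have "space (rand P) - A u j = (\<Union>v\<in>{1..t}. space (rand P) - V (X u) (Y j v))"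
      by (auto simp: A_def)
    then have "prob (space (rand P) - A u j) =
        prob (\<Union>v\<in>{1..t}. space (rand P) - V (X u) (Y j v))"
      by (rule arg_cong)
    also have "\<dots> \<le> (\<Sum>v\<in>{1..t}. prob (space (rand P) - V (X u) (Y j v)))"
      by (intro finite_measure_subadditive_finite image_subsetI sets.Diff sets.top V(1) XS YSv)
        simp_all
    also have "\<dots> \<le> (\<Sum>v\<in>{1..t}. 1 / (real m + 1))"
    proof (rule sum_mono)
      fix v assume v: "v \<in> {1..t}"
      from V[OF XS[of u] YSv[OF v]] \<delta> show "prob (space (rand P) - V (X u) (Y j v)) \<le> 1 / (real m + 1)"
        by (subst prob_compl) auto
    qed
    also have "\<dots> \<le> 1 / 3" using t(3) by (simp add: field_simps)
    finally show "2 / 3 \<le> prob (A u j)" using prob_compl[OF A] by simp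
  next
    fix u j \<omega> assume u: "u \<in> {..<K} \<rightarrow>\<^sub>E {..<T}" and j: "j < K" and \<omega>: "\<omega> \<in> A u j"
    have eq: "bob P \<omega> (alice P \<omega> (X u)) (Y j v) \<longleftrightarrow> u j = v" if v: "v \<in> {1..t}" for v
    proof -
      have valid: "DTEP_valid line_dist 1 \<alpha> (X u) (Y j v) (bob P \<omega> (alice P \<omega> (X u)) (Y j v))"
        using \<omega> v by (auto simp: A_def V_def run_protocol_def)
      have v': "0 < v" "v < T" using v by (auto simp: T_def)
      show ?thesis
      proof (cases "u j = v")
        case True
        have "ereal \<alpha> < ereal (real L)" using L by simp
        also have "\<dots> \<le> DTW line_dist (X u) (Y j v)"
          using DTW_ge_run_length[OF v' L(1), of j "map u [0..<K]"] j True by (simp add: X_def Y_def)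
        finally show ?thesis using valid True by (simp add: DTEP_valid_def)
      next
        case False
        have "DTW line_dist (X u) (Y j v) \<le> 1"
          using DTW_le_one[OF v', of L j "map u [0..<K]"] L(1) j False by (simp add: X_def Y_def)
        then show ?thesis using valid False by (simp add: DTEP_valid_def one_ereal_def)
      qed
    qed
    have "u j < T" using u j by auto
    then have "u j = 0 \<or> u j \<in> {1..t}" by (auto simp: T_def)
    then show "dec \<omega> (alice P \<omega> (X u)) j = u j"
      using eq by (auto simp: dec_def intro!: the_equality)
  qed
  moreover have "log 2 (real m) \<le> 3 * log 2 (real T)"
  proof -
    \<comment> \<open>\<open>T >= 2\<close> gives \<open>T ^ 2 >= 4\<close>; combined with
      \<open>m <= 3 * T\<close> this bounds \<open>m\<close> by \<open>T ^ 3\<close>.\<close>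
    have "3 * T \<le> T ^ 3"
    proof -
      have "2 ^ 2 \<le> T ^ 2" using t(1) by (intro power_mono) (auto simp: T_def)
      then have "3 * T \<le> T ^ 2 * T" by (intro mult_right_mono) auto
      then show ?thesis by (simp add: power_numeral_reduce)
    qed
    with t(4) have "real m \<le> real T ^ 3" by (metis of_nat_le_iff of_nat_power order_trans)
    then have "log 2 (real m) \<le> log 2 (real T ^ 3)" using m t by (subst log_le_cancel_iff) auto
    then show ?thesis by (simp add: log_nat_power T_def)
  qed
  moreover have "real n / \<alpha> * log 2 (real m) \<le> (2 * real K) * (3 * log 2 (real T))"
    using calculation K(2) m by (intro mult_mono) auto
  ultimately show ?thesis by simp
qed

theorem theoremA1:
  "\<exists>(C::nat) (c::real). c > 0 \<and>
     (\<forall>(n::nat) (m::nat) (\<alpha>::real) (\<delta>::real) (P :: (nat list, nat list, bool) one_way).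
        1 \<le> \<alpha> \<longrightarrow> \<alpha> \<le> real n \<longrightarrow> 2 \<le> m \<longrightarrow> real m \<le> \<alpha> \<longrightarrow> \<delta> \<le> 1 / (real m + 1) \<longrightarrow>
        DTEP_protocol line_dist 1 \<alpha> (strings_upto {0..m} (C * n)) (1 - \<delta>) P \<longrightarrow>
        ereal (c * (real n / \<alpha> * log 2 (real m)))
          \<le> ereal_of_enat (bit_complexity (strings_upto {0..m} (C * n)) P))"
proof (intro exI[of _ "8 :: nat"] exI[of _ "1 / 180 :: real"] conjI allI impI)
  fix n m :: nat and \<alpha> \<delta> :: real and P :: "(nat list, nat list, bool) one_way"
  assume *: "1 \<le> \<alpha>" "\<alpha> \<le> real n" "2 \<le> m" "real m \<le> \<alpha>" "\<delta> \<le> 1 / (real m + 1)"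
    "DTEP_protocol line_dist 1 \<alpha> (strings_upto {0..m} (8 * n)) (1 - \<delta>) P"
  show "ereal (1 / 180 * (real n / \<alpha> * log 2 (real m)))
      \<le> ereal_of_enat (bit_complexity (strings_upto {0..m} (8 * n)) P)"
  proof (cases "bit_complexity (strings_upto {0..m} (8 * n)) P")
    case (enat B)
    have "1 / 180 * (real n / \<alpha> * log 2 (real m)) \<le> 1 / 180 * (180 * real B)"
      by (intro mult_left_mono DTEP_lower_bound[OF * enat]) simp
    also have "\<dots> = real B" by simp
    finally show ?thesis by (simp only: enat ereal_of_enat_simps ereal_less_eq)
  next
    case infinity
    then show ?thesis by simp
  qed
qed simp

end
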